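(* Let $n,r,s$ be integers with $n\geq 2r+1$, $r>0$ and $s\geq 1$. Then $\Lambda_{n,r,s}(1)=\dfrac{1-s}{n!}$ and $$\Lambda_{n-1,r-1,s}(\tau)=\frac{d\,\Lambda_{n,r,s}(\tau)}{d\tau}.$$
   Context: For integers $n\geq 2r+1$, $r\geq 0$, $s\geq 1$, $m\geq 1$ let $$c_{n,r,m,t}=\sum_{0\leq i<m}\binom{t-i+r}{r}\binom{i+n-r-1}{n-r-1},$$ regarded as a polynomial in $t$ (with $\binom{x+a}{a}=\frac{(x+a)\cdots(x+1)}{a!}$), and let $P_{n,r,s,m}(t)=\binom{t+n}{n}-s\,c_{n,r,m,t}$, a polynomial in $t$ of degree $n$. Substituting $t=m\tau$, the expression $P_{n,r,s,m}(m\tau)$ is a polynomial in $m$ of degree $n$ with coefficients in $\mathbb{Q}[\tau]$; $\Lambda_{n,r,s}(\tau)\in\mathbb{Q}[\tau]$ denotes the coefficient of $m^n$ in it. *)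

theory Defs
  imports "HOL-Computational_Algebra.Polynomial"
begin

text \<open>
  The polynomial binomial coefficient \<open>binom(p + a, a) = (p + a) \<cdots> (p + 1) / a!\<close>,
  with a polynomial \<open>p\<close> in the upper argument.
\<close>

definition shifted_binom :: "rat poly \<Rightarrow> nat \<Rightarrow> rat poly" where
  "shifted_binom p a = smult (1 / fact a) (\<Prod>j = 1..a. p + of_nat j)"

text \<open>
  The indeterminate of the polynomials below is \<open>t\<close>, that is \<open>[:0, 1:]\<close>; \<open>[:- of_nat i, 1:]\<close>
  is \<open>t - i\<close>. The natural-number subtractions are exact since \<open>n \<ge> 2 * r + 1\<close> is assumed
  whenever these polynomials are used.
\<close>

definition c_poly :: "nat \<Rightarrow> nat \<Rightarrow> nat \<Rightarrow> rat poly" where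
  "c_poly n r m =
     (\<Sum>i<m. shifted_binom [:- of_nat i, 1:] r * of_nat ((i + n - r - 1) choose (n - r - 1)))"

definition P_poly :: "nat \<Rightarrow> nat \<Rightarrow> nat \<Rightarrow> nat \<Rightarrow> rat poly" where
  "P_poly n r s m = shifted_binom [:0, 1:] n - of_nat s * c_poly n r m"

text \<open>
  \<open>P_poly n r s m\<close> at \<open>t = m \<tau>\<close>, as a polynomial in \<open>m\<close> with coefficients in \<open>\<rat>[\<tau>]\<close>: the outer
  indeterminate of the \<^typ>\<open>rat poly poly\<close> is \<open>m\<close> and the inner one is \<open>\<tau>\<close>. It is determined
  by its values at the integers \<open>m \<ge> 1\<close>, the only ones for which \<open>P_poly n r s m\<close> is considered.
\<close>

definition P_scaled :: "nat \<Rightarrow> nat \<Rightarrow> nat \<Rightarrow> rat poly poly" where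
  "P_scaled n r s =
     (THE Q. \<forall>m\<ge>1. poly Q (of_nat m) = pcompose (P_poly n r s m) [:0, of_nat m:])"

definition Lambda :: "nat \<Rightarrow> nat \<Rightarrow> nat \<Rightarrow> rat poly" where
  "Lambda n r s = coeff (P_scaled n r s) n"

end

theory Submission
  imports Defs
begin

text \<open>
  Write \<open>B\<^sub>a(x)\<close> for \<^term>\<open>shifted_binom x a\<close>. Since \<open>B\<^sub>a(x) - B\<^sub>a(x - 1) = B\<^bsub>a-1\<^esub>(x)\<close>, summation
  by parts lowers the index of one factor of \<open>\<Sum>i<m. B\<^sub>r(t - i) B\<^sub>k(i)\<close> and raises that of the
  other; \<open>r\<close> such steps and \<open>n = r + k + 1\<close> give the closed form
  \<open>\<Sum>a\<le>r. B\<^sub>a(t - m) B\<^bsub>n-a\<^esub>(m - 1)\<close> (lemma \<open>sum_shifted_binom_mult\<close>). After \<open>t = m \<tau>\<close> this is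
  visibly a polynomial in \<open>m\<close>, and \<open>B\<^sub>a(m (\<tau> - 1))\<close> and \<open>B\<^bsub>n-a\<^esub>(m - 1)\<close> contribute the leading
  coefficients \<open>(\<tau> - 1)\<^sup>a / a!\<close> and \<open>1 / (n - a)!\<close>. Hence (lemma \<open>Lambda_eq\<close>)
  \<open>\<Lambda>(\<tau>) = \<tau>\<^sup>n / n! - s (\<Sum>a\<le>r. (\<tau> - 1)\<^sup>a / (a! (n - a)!))\<close>,
  where the sum is the Taylor polynomial of degree \<open>r\<close> of \<open>\<tau>\<^sup>n / n!\<close> at \<open>1\<close>. At \<open>\<tau> = 1\<close>
  only its term \<open>a = 0\<close>, which is \<open>1 / n!\<close>, survives, and differentiation maps the Taylor polynomial of degree \<open>r\<close>
  of \<open>\<tau>\<^sup>n / n!\<close> to that of degree \<open>r - 1\<close> of its derivative \<open>\<tau>\<^bsup>n-1\<^esup> / (n - 1)!\<close>.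
\<close>

lemma shifted_binom_0 [simp]: "shifted_binom x 0 = 1"
  by (simp add: shifted_binom_def)

lemma shifted_binom_minus_one [simp]: "shifted_binom (- 1) (Suc a) = 0"
  by (auto simp: shifted_binom_def prod_zero_iff intro!: bexI[of _ 1])

lemma shifted_binom_pascal:
  "shifted_binom x (Suc a) = shifted_binom (x - 1) (Suc a) + shifted_binom x a"
proof -
  define R where "R = (\<Prod>j = 1..a. x + of_nat j)"
  have up: "(\<Prod>j = 1..Suc a. x + of_nat j) = (x + of_nat (Suc a)) * R"
    by (simp add: R_def mult.commute)
  have "(\<Prod>j = 1..Suc a. x - 1 + of_nat j) = x * (\<Prod>j = Suc 1..Suc a. x - 1 + of_nat j)"
    by (subst prod.atLeast_Suc_atMost) auto
  also have "(\<Prod>j = Suc 1..Suc a. x - 1 + of_nat j) = R"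
    unfolding R_def prod.shift_bounds_cl_Suc_ivl by simp
  finally have down: "(\<Prod>j = 1..Suc a. x - 1 + of_nat j) = x * R" .
  have "of_nat (Suc a) * R = smult (of_nat (Suc a)) R"
    by (simp add: of_nat_poly)
  hence "smult (1 / fact (Suc a)) (of_nat (Suc a) * R) = smult (1 / fact a) R"
    by (simp del: of_nat_Suc add: fact_Suc)
  thus ?thesis
    unfolding shifted_binom_def up down R_def [symmetric]
    by (simp only: distrib_right smult_add_right)
qed

lemma shifted_binom_of_nat: "shifted_binom (of_nat i) k = of_nat ((i + k) choose k)"
proof (induction k arbitrary: i)
  case (Suc k)
  note IH = Suc.IH
  show ?case
  proof (induction i)
    case 0
    show ?case
      using shifted_binom_pascal[of 0 k] IH[of 0] by simp
  next
    case (Suc i)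
    show ?case
      using shifted_binom_pascal[of "of_nat (Suc i)" k] IH[of "Suc i"] Suc
      by (simp add: add_ac)
  qed
qed simp

text \<open>
  One summation by parts: \<open>B\<^sub>k\<close> is the backward difference of \<open>B\<^bsub>k+1\<^esub>\<close>, and the lower boundary
  term vanishes because \<open>B\<^bsub>k+1\<^esub>(-1) = 0\<close>.
\<close>

lemma sum_shifted_binom_by_parts:
  "(\<Sum>i<m. shifted_binom (p - of_nat i) (Suc r) * shifted_binom (of_nat i) k) =
   shifted_binom (p - of_nat m) (Suc r) * shifted_binom (of_nat m - 1) (Suc k) +
   (\<Sum>i<m. shifted_binom (p - of_nat i) r * shifted_binom (of_nat i) (Suc k))"
proof (induction m)
  case (Suc m)
  have eq: "p - of_nat m - 1 = p - of_nat (Suc m)" "of_nat (Suc m) - 1 = (of_nat m :: rat poly)"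
    by simp_all
  have 1: "shifted_binom (of_nat m) k =
      shifted_binom (of_nat m) (Suc k) - shifted_binom (of_nat m - 1) (Suc k)"
    by (simp add: shifted_binom_pascal[of "of_nat m" k])
  have 2: "shifted_binom (p - of_nat m) (Suc r) =
      shifted_binom (p - of_nat (Suc m)) (Suc r) + shifted_binom (p - of_nat m) r"
    using shifted_binom_pascal[of "p - of_nat m" r] unfolding eq .
  show ?case
    unfolding sum.lessThan_Suc Suc.IH eq(2) 1
    by (simp only: 2 algebra_simps)
qed simp

lemma sum_shifted_binom_mult:
  "(\<Sum>i<m. shifted_binom (p - of_nat i) r * shifted_binom (of_nat i) k) =
   (\<Sum>a\<le>r. shifted_binom (p - of_nat m) a * shifted_binom (of_nat m - 1) (r + k + 1 - a))"
proof (induction r arbitrary: k)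
  case 0
  have "(\<Sum>i<m. shifted_binom (of_nat i) k) = shifted_binom (of_nat m - 1) (Suc k)"
  proof (induction m)
    case (Suc m)
    then show ?case by (simp add: shifted_binom_pascal[of "of_nat m" k])
  qed simp
  then show ?case by simp
next
  case (Suc r)
  show ?case
    unfolding sum_shifted_binom_by_parts Suc.IH by (simp add: algebra_simps Suc_diff_le)
qed

lemma pcompose_shifted_binom:
  "pcompose (shifted_binom p a) q = shifted_binom (pcompose p q) a"
proof -
  have [simp]: "pcompose (of_nat j) q = of_nat j" for j
    by (simp add: of_nat_poly)
  show ?thesis
    by (simp add: shifted_binom_def pcompose_smult pcompose_prod pcompose_add)
qed

lemma c_poly_eq_sum_shifted_binom:
  assumes "r < n"
  shows "c_poly n r m = (\<Sum>a\<le>r. shifted_binom ([:0, 1:] - of_nat m) a *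
                               shifted_binom (of_nat m - 1) (n - a))"
proof -
  have n: "i + n - r - 1 = i + (n - r - 1)" "r + (n - r - 1) + 1 = n" for i
    using assms by auto
  have t: "[:- of_nat i, 1:] = [:0, 1:] - (of_nat i :: rat poly)" for i
    by (simp add: of_nat_poly)
  show ?thesis
    unfolding c_poly_def t n(1) shifted_binom_of_nat[symmetric] sum_shifted_binom_mult n(2) ..
qed

text \<open>
  The polynomial \<open>B\<^sub>a(u X + v)\<close> in an indeterminate \<open>X\<close> over \<open>\<rat>[\<tau>]\<close>, so that \<open>X\<close> can play the
  role of \<open>m\<close>.
\<close>

definition linear_binom :: "rat poly \<Rightarrow> rat poly \<Rightarrow> nat \<Rightarrow> rat poly poly" where
  "linear_binom u v a = smult [:1 / fact a:] (\<Prod>j = 1..a. [:v + of_nat j, u:])"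

lemma poly_linear_binom: "poly (linear_binom u v a) x = shifted_binom (u * x + v) a"
  by (simp add: linear_binom_def shifted_binom_def poly_prod algebra_simps)

lemma degree_prod_linear_le: "degree (\<Prod>j = 1..a. [:v + of_nat j, u:]) \<le> a"
proof -
  have "degree (\<Prod>j = 1..a. [:v + of_nat j, u:]) \<le> (\<Sum>j = 1..a. degree [:v + of_nat j, u:])"
    by (rule order.trans[OF degree_prod_sum_le]) auto
  also have "\<dots> \<le> (\<Sum>j = 1..a. 1)"
    by (intro sum_mono) simp
  finally show ?thesis by simp
qed

lemma degree_linear_binom_le: "degree (linear_binom u v a) \<le> a"
  unfolding linear_binom_def
  using degree_smult_le degree_prod_linear_le by (rule order.trans)

lemma coeff_linear_binom: "coeff (linear_binom u v a) a = smult (1 / fact a) (u ^ a)"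
proof -
  have "coeff (\<Prod>j = 1..a. [:v + of_nat j, u:]) a = u ^ a"
  proof (induction a)
    case (Suc a)
    have "coeff (\<Prod>j = 1..a. [:v + of_nat j, u:]) (Suc a) = 0"
      using degree_prod_linear_le[of v u a] by (intro coeff_eq_0) simp
    with Suc show ?case
      by (simp add: mult.commute[of _ "[:_, _:]"])
  qed simp
  then show ?thesis by (simp add: linear_binom_def)
qed

lemma coeff_mult_linear_binom:
  "coeff (linear_binom u v a * linear_binom u' v' b) (a + b) =
   smult (1 / (fact a * fact b)) (u ^ a * u' ^ b)"
proof -
  have "coeff (linear_binom u v a * linear_binom u' v' b) (a + b) =
        coeff (linear_binom u v a) a * coeff (linear_binom u' v' b) b"
    unfolding coeff_mult
  proof (subst sum.remove[of _ a])
    have "coeff (linear_binom u v a) i * coeff (linear_binom u' v' b) (a + b - i) = 0"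
      if "i \<noteq> a" for i
    proof (cases "i < a")
      case True
      then show ?thesis
        using degree_linear_binom_le[of u' v' b] by (simp add: coeff_eq_0)
    next
      case False
      then show ?thesis
        using that degree_linear_binom_le[of u v a] by (simp add: coeff_eq_0)
    qed
    then have "(\<Sum>i\<in>{..a + b} - {a}.
        coeff (linear_binom u v a) i * coeff (linear_binom u' v' b) (a + b - i)) = 0"
      by (intro sum.neutral) blast
    then show "coeff (linear_binom u v a) a * coeff (linear_binom u' v' b) (a + b - a) +
        (\<Sum>i\<in>{..a + b} - {a}. coeff (linear_binom u v a) i * coeff (linear_binom u' v' b) (a + b - i))
        = coeff (linear_binom u v a) a * coeff (linear_binom u' v' b) b"
      by simp
  qed auto
  then show ?thesis by (simp add: coeff_linear_binom mult.commute)
qed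

text \<open>
  The values at all \<open>m \<ge> 1\<close> form an infinite set of interpolation points in the integral domain
  \<open>\<rat>[\<tau>]\<close>, so exhibiting one interpolating polynomial identifies \<^const>\<open>P_scaled\<close>.
\<close>

lemma poly_eqI_of_nat:
  fixes P Q :: "'a :: {idom, ring_char_0} poly"
  assumes "\<And>m. m \<ge> 1 \<Longrightarrow> poly P (of_nat m) = poly Q (of_nat m)"
  shows "P = Q"
proof (rule ccontr)
  assume "P \<noteq> Q"
  then have "finite {x. poly (P - Q) x = 0}"
    by (intro poly_roots_finite) simp
  moreover have "of_nat ` {1..} \<subseteq> {x. poly (P - Q) x = 0}"
    using assms by auto
  ultimately have "finite (of_nat ` {1..} :: 'a set)"
    by (rule finite_subset[rotated])
  then have "finite {1::nat..}"
    by (rule finite_imageD) (simp add: inj_on_def)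
  then show False
    by (simp add: infinite_Ici)
qed

lemma P_scaled_eq:
  assumes "r < n"
  shows "P_scaled n r s = linear_binom [:0, 1:] 0 n -
    of_nat s * (\<Sum>a\<le>r. linear_binom [:- 1, 1:] 0 a * linear_binom 1 (- 1) (n - a))"
    (is "_ = ?Q")
proof -
  have Q: "poly ?Q (of_nat m) = pcompose (P_poly n r s m) [:0, of_nat m:]" for m
  proof -
    have const: "pcompose (of_nat j) [:0, of_nat m:] = (of_nat j :: rat poly)" for j
      by (simp add: of_nat_poly)
    have t: "pcompose [:0, 1:] [:0, of_nat m:] = [:0, 1:] * (of_nat m :: rat poly)"
      by (simp add: of_nat_poly pcompose_pCons)
    have t': "[:0, 1:] * of_nat m - of_nat m = [:- 1, 1:] * (of_nat m :: rat poly)"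
      by (simp add: of_nat_poly)
    show ?thesis
      by (simp only: P_poly_def c_poly_eq_sum_shifted_binom[OF assms] pcompose_diff pcompose_mult
          pcompose_sum pcompose_shifted_binom const t t' pcompose_1 poly_diff poly_mult poly_sum
          poly_linear_binom poly_of_nat mult_1_left add_0_right add_uminus_conv_diff)
  qed
  show ?thesis
    unfolding P_scaled_def
  proof (rule the_equality)
    show "\<forall>m\<ge>1. poly ?Q (of_nat m) = pcompose (P_poly n r s m) [:0, of_nat m:]"
      using Q by blast
    show "P = ?Q" if "\<forall>m\<ge>1. poly P (of_nat m) = pcompose (P_poly n r s m) [:0, of_nat m:]" for P
      by (rule poly_eqI_of_nat) (use that Q in simp)
  qed
qed

lemma Lambda_eq:
  assumes "r < n"
  shows "Lambda n r s = smult (1 / fact n) ([:0, 1:] ^ n) -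
    smult (of_nat s) (\<Sum>a\<le>r. smult (1 / (fact a * fact (n - a))) ([:- 1, 1:] ^ a))"
proof -
  have "coeff (linear_binom [:- 1, 1:] 0 a * linear_binom 1 (- 1) (n - a)) n =
        smult (1 / (fact a * fact (n - a))) ([:- 1, 1:] ^ a)" if "a \<le> r" for a
    using coeff_mult_linear_binom[of "[:- 1, 1:]" 0 a 1 "- 1" "n - a"] that assms by simp
  then show ?thesis
    by (simp add: Lambda_def P_scaled_eq[OF assms] coeff_linear_binom of_nat_poly coeff_sum)
qed

theorem corollary2p9:
  fixes n r s :: nat
  assumes "n \<ge> 2 * r + 1" and "r > 0" and "s \<ge> 1"
  shows "poly (Lambda n r s) 1 = (1 - of_nat s) / fact n \<and>
         Lambda (n - 1) (r - 1) s = pderiv (Lambda n r s)"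
proof
  have "r < n" using assms by simp
  show "poly (Lambda n r s) 1 = (1 - of_nat s) / fact n"
    by (simp add: Lambda_eq[OF \<open>r < n\<close>] poly_sum power_0_left if_distrib sum.delta
        diff_divide_distrib cong: if_cong)
  obtain n' r' where n': "n = Suc n'" and r': "r = Suc r'"
    using assms by (metis Suc_pred \<open>r < n\<close> less_trans)
  have fact_cancel: "of_nat (Suc b) / (fact (Suc b) * c) = 1 / (fact b * c)" for b and c :: rat
    by (simp add: fact_Suc del: of_nat_Suc)
  \<comment> \<open>The factor \<open>c\<close> is \<open>1\<close> for \<open>\<tau>\<^sup>n / n!\<close> and \<open>(n - a)!\<close> for the terms of the Taylor polynomial.\<close>
  have deriv: "pderiv (smult (1 / (fact (Suc b) * c)) ([:d, 1:] ^ Suc b)) =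
      smult (1 / (fact b * c)) ([:d, 1:] ^ b)" for b and c d :: rat
    using fact_cancel[of b c]
    by (simp add: pderiv_smult pderiv_power_Suc pderiv_pCons del: of_nat_Suc fact_Suc power_Suc)
  \<comment> \<open>The term \<open>a = 0\<close> is constant; the term \<open>a + 1\<close> maps to the term \<open>a\<close> for \<open>n - 1\<close>.\<close>
  have "pderiv (Lambda n r s) = smult (1 / fact n') ([:0, 1:] ^ n') -
      smult (of_nat s) (\<Sum>a\<le>r'. smult (1 / (fact a * fact (n' - a))) ([:- 1, 1:] ^ a))"
    using deriv[of n' 1 0]
    by (simp add: Lambda_eq[OF \<open>r < n\<close>, unfolded r' n'] r' n' sum.atMost_Suc_shift pderiv_diff
        pderiv_smult[of "of_nat s"] pderiv_add higher_pderiv_sum[where n = 1, simplified] deriv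
        del: sum.atMost_Suc fact_Suc power_Suc)
  also have "\<dots> = Lambda (n - 1) (r - 1) s"
    using Lambda_eq[of r' n' s] \<open>r < n\<close> n' r' by simp
  finally show "Lambda (n - 1) (r - 1) s = pderiv (Lambda n r s)" ..
qed

end
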